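(* Let $N=1$ and let $p>1$ be fixed. There exists a constant $C_p>0$ such that $$\mathcal{W}_p^p(B)-\mathcal{W}_p^p(\rho)\ge C_p\,A(\rho)^2\qquad\text{for all }\rho\in\mathsf{A},$$ where $B\subset\mathbb{R}$ is a ball (interval) with $|B|=1$ and $\mathcal{W}_p(B)=\mathcal{W}_p(\chi_B)$.
   Context: Everything is on $\mathbb{R}$ with Lebesgue measure; $|E|$ is the Lebesgue measure of $E$, and $B_r(x)$ is the open ball of center $x$ and radius $r$. The class of densities is $$\mathsf{A}=\left\{\rho\in L^1(\mathbb{R})\colon 0\le\rho\le 1,\ \int\rho\,dx=1\right\}.$$ For nonnegative finite Borel measures $\mu_1,\mu_2$ of equal total mass, $W_p^p(\mu_1,\mu_2)=\inf\iint|x-y|^p\,d\pi(x,y)$ over all nonnegative Borel measures $\pi$ on $\mathbb{R}\times\mathbb{R}$ with marginals $\mu_1,\mu_2$. A density is identified with the measure it defines. For $\rho\in\mathsf{A}$, $$\mathcal{W}_p(\rho)=\inf\left\{W_p(\rho,\rho')\colon 0\le\rho',\ 0\le\rho+\rho'\le 1,\ \int\rho'\,dx=\int\rho\,dx\right\},$$ and $\mathcal{W}_p^p(\rho)=(\mathcal{W}_p(\rho))^p$. The asymmetry of $\rho\in\mathsf{A}$ is $$A(\rho)=\inf\left\{\|\rho-\chi_{B_r(x)}\|_{L^1}\colon x\in\mathbb{R},\ |B_r(x)|=1\right\}.$$ *)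

theory Defs
  imports "HOL-Analysis.Analysis"
begin

text \<open>
  Elements of \<open>L\<^sup>1\<close> are represented by Borel functions (every class of Lebesgue integrable
  functions contains one), and pointwise constraints on them are imposed almost everywhere.
\<close>

definition densities :: "(real \<Rightarrow> real) set" where
  "densities = {\<rho>. integrable lborel \<rho> \<and> (AE x in lborel. 0 \<le> \<rho> x \<and> \<rho> x \<le> 1) \<and>
     (\<integral>x. \<rho> x \<partial>lborel) = 1}"

definition density_measure :: "(real \<Rightarrow> real) \<Rightarrow> real measure" where
  "density_measure \<rho> = density lborel (\<lambda>x. ennreal (\<rho> x))"

definition couplings :: "real measure \<Rightarrow> real measure \<Rightarrow> (real \<times> real) measure set" where
  "couplings \<mu> \<nu> = {\<pi>. sets \<pi> = sets borel \<and> distr \<pi> borel fst = \<mu> \<and> distr \<pi> borel snd = \<nu>}"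

text \<open>
  Transport costs may be infinite, so they take values in \<^typ>\<open>ennreal\<close>. The library has no real
  powers on that type; the following is the power \<open>x\<^sup>a\<close> for \<open>a > 0\<close>, with \<open>\<infinity>\<^sup>a = \<infinity>\<close>.
\<close>

definition ennpowr :: "ennreal \<Rightarrow> real \<Rightarrow> ennreal" where
  "ennpowr x a = (if x = \<infinity> then \<infinity> else ennreal (enn2real x powr a))"

definition wasserstein_cost :: "real \<Rightarrow> real measure \<Rightarrow> real measure \<Rightarrow> ennreal" where
  "wasserstein_cost p \<mu> \<nu> =
     (INF \<pi>\<in>couplings \<mu> \<nu>. \<integral>\<^sup>+ z. ennreal (\<bar>fst z - snd z\<bar> powr p) \<partial>\<pi>)"

definition wasserstein :: "real \<Rightarrow> real measure \<Rightarrow> real measure \<Rightarrow> ennreal" where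
  "wasserstein p \<mu> \<nu> = ennpowr (wasserstein_cost p \<mu> \<nu>) (1 / p)"

definition competitors :: "(real \<Rightarrow> real) \<Rightarrow> (real \<Rightarrow> real) set" where
  "competitors \<rho> = {\<rho>'. integrable lborel \<rho>' \<and> (AE x in lborel. 0 \<le> \<rho>' x) \<and>
     (AE x in lborel. 0 \<le> \<rho> x + \<rho>' x \<and> \<rho> x + \<rho>' x \<le> 1) \<and>
     (\<integral>x. \<rho>' x \<partial>lborel) = (\<integral>x. \<rho> x \<partial>lborel)}"

definition W_free :: "real \<Rightarrow> (real \<Rightarrow> real) \<Rightarrow> ennreal" where
  "W_free p \<rho> = (INF \<rho>'\<in>competitors \<rho>. wasserstein p (density_measure \<rho>) (density_measure \<rho>'))"

definition asymmetry :: "(real \<Rightarrow> real) \<Rightarrow> real" where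
  "asymmetry \<rho> = Inf {\<integral>y. \<bar>\<rho> y - indicator (ball x r) y\<bar> \<partial>lborel | x r. measure lborel (ball x r) = 1}"

lemma unit_ball_radius:
  fixes x r :: real
  assumes "measure lborel (ball x r) = 1"
  shows "r = 1/2"
proof -
  have e: "ball x r = {x - r<..<x + r}" by (rule ball_eq_greaterThanLessThan)
  have "r > 0" using assms by (cases "r > 0") (auto simp: ball_empty)
  then have "measure lborel (ball x r) = 2 * r" unfolding e by simp
  with assms show ?thesis by simp
qed

text \<open>
  \<^term>\<open>W_free p\<close> is finite at the indicator function of a ball of unit volume: move the ball by its
  length. Hence a difference of extended reals \<open>W_free p (indicator B) - c\<close>, with \<open>c\<close> nonnegative,
  never has the form \<open>\<infinity> - \<infinity>\<close>.
\<close>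

lemma W_free_unit_ball_finite:
  fixes x r :: real
  assumes "measure lborel (ball x r) = 1"
  shows "W_free p (indicator (ball x r)) < \<infinity>"
proof -
  let ?f = "indicator (ball x r) :: real \<Rightarrow> real"
  let ?g = "indicator (ball (x + 1) r) :: real \<Rightarrow> real"
  have r: "r = 1/2" using unit_ball_radius[OF assms] .
  have e: "ball x r = {x - 1/2<..<x + 1/2}" "ball (x+1) r = {x + 1/2<..<x + 3/2}"
    unfolding r ball_eq_greaterThanLessThan by auto
  have [measurable]: "ball y t \<in> sets borel" for y t :: real by (rule borel_open) simp
  have g: "?g \<in> competitors ?f"
    unfolding competitors_def e by (auto simp: indicator_def)
  define \<pi> where "\<pi> = distr (density_measure ?f) borel (\<lambda>y. (y, y + 1))"
  have s: "sets (density_measure h) = sets borel" for h by (simp add: density_measure_def)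
  have m: "(\<lambda>y::real. (y, y + 1)) \<in> density_measure ?f \<rightarrow>\<^sub>M borel"
    unfolding measurable_cong_sets[OF s refl] borel_prod[symmetric] by measurable
  have "distr \<pi> borel fst = distr (density_measure ?f) borel (\<lambda>y. y)"
    unfolding \<pi>_def by (subst distr_distr[OF _ m]) (simp_all add: comp_def borel_measurable_continuous_onI continuous_on_fst)
  also have "\<dots> = density_measure ?f" by (rule distr_id2) (simp add: s)
  finally have 1: "distr \<pi> borel fst = density_measure ?f" .
  have "distr \<pi> borel snd = distr (density_measure ?f) borel (\<lambda>y. y + 1)"
    unfolding \<pi>_def by (subst distr_distr[OF _ m]) (simp_all add: comp_def borel_measurable_continuous_onI continuous_on_snd)
  also have "\<dots> = density_measure ?g"
  proof (rule measure_eqI)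
    fix A assume "A \<in> sets (distr (density_measure ?f) borel (\<lambda>y. y + 1))"
    then have A [measurable]: "A \<in> sets borel" by simp
    have m1: "(\<lambda>y::real. y + 1) \<in> density_measure ?f \<rightarrow>\<^sub>M borel"
      unfolding measurable_cong_sets[OF s refl] by measurable
    have pre [measurable]: "(\<lambda>y::real. y + 1) -` A \<in> sets borel"
      using measurable_sets[of "\<lambda>y::real. y + 1" borel borel A] A by simp
    have "emeasure (density_measure ?g) A =
        (\<integral>\<^sup>+ y. ennreal (?g y) * indicator A y \<partial>lborel)"
      unfolding density_measure_def e using A by (subst emeasure_density) simp_all
    also have "\<dots> = (\<integral>\<^sup>+ y. ennreal (?g y) * indicator A y \<partial>distr lborel borel ((+) 1))"
      by (simp add: lborel_distr_plus)
    also have "\<dots> = (\<integral>\<^sup>+ y. ennreal (?g (1 + y)) * indicator A (1 + y) \<partial>lborel)"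
      by (subst nn_integral_distr) simp_all
    also have "\<dots> = (\<integral>\<^sup>+ y. ennreal (?f y) * indicator ((\<lambda>y. y + 1) -` A) y \<partial>lborel)"
      by (rule nn_integral_cong) (auto simp: r dist_real_def indicator_def add.commute)
    also have "\<dots> = emeasure (distr (density_measure ?f) borel (\<lambda>y. y + 1)) A"
      using A pre unfolding density_measure_def e
      by (subst emeasure_distr) (simp_all add: emeasure_density)
    finally show "emeasure (distr (density_measure ?f) borel (\<lambda>y. y + 1)) A = emeasure (density_measure ?g) A" ..
  qed (simp add: s)
  finally have 2: "distr \<pi> borel snd = density_measure ?g" .
  have \<pi>: "\<pi> \<in> couplings (density_measure ?f) (density_measure ?g)"
    unfolding couplings_def using 1 2 by (simp add: \<pi>_def)
  have "wasserstein_cost p (density_measure ?f) (density_measure ?g)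
      \<le> (\<integral>\<^sup>+ z. ennreal (\<bar>fst z - snd z\<bar> powr p) \<partial>\<pi>)"
    unfolding wasserstein_cost_def by (rule INF_lower[OF \<pi>])
  also have "\<dots> = (\<integral>\<^sup>+ y. ennreal (\<bar>y - (y + 1)\<bar> powr p) \<partial>density_measure ?f)"
    unfolding \<pi>_def by (subst nn_integral_distr[OF m]) (simp_all add: borel_prod[symmetric])
  also have "\<dots> = (\<integral>\<^sup>+ y. indicator (ball x r) y \<partial>lborel)"
    by (simp add: density_measure_def emeasure_density ennreal_indicator)
  also have "\<dots> < \<infinity>" by (simp add: e)
  finally have "wasserstein p (density_measure ?f) (density_measure ?g) < \<infinity>"
    by (simp add: wasserstein_def ennpowr_def)
  moreover have "W_free p ?f \<le> wasserstein p (density_measure ?f) (density_measure ?g)"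
    unfolding W_free_def by (rule INF_lower[OF g])
  ultimately show ?thesis by (rule le_less_trans[rotated])
qed

end

theory Submission
  imports Defs "HOL-Probability.Probability"
begin

text \<open>
  Lower bound for the ball: the tangent line of \<open>t\<^sup>p\<close> at \<open>1/2\<close> together with the 1-Lipschitz
  potential \<open>tent\<close> gives \<open>W\<^sub>p\<^sup>p(B) \<ge> (1/2)\<^sup>p\<close>.

  Upper bound for a density \<open>\<rho>\<close> with median \<open>m\<close> and \<open>\<Phi>(x) = \<integral>\<^bsub>-\<infinity>\<^esub>\<^bsup>x\<^esup> \<rho> - 1/2\<close>: process the mass on each side
  of \<open>m\<close> outwards and put it greedily into the free space of that side, where the mass at distance
  \<open>d\<close> from \<open>m\<close> may use places at distance at least \<open>d - 1/4\<close>. Mass at position \<open>x\<close> is then moved by at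
  most \<open>max (1/4) (1/2 - g)\<close>, where \<open>g\<close> is the free volume between \<open>m\<close> and \<open>x\<close>. If \<open>a\<close> is the mass to
  the right of \<open>m + 1/2\<close>, then \<open>g \<ge> a\<close> there, so this mass saves a cost of order \<open>a\<^sup>2\<close>; the same holds
  on the left with the mass \<open>b\<close>, and the asymmetry is at most \<open>2 (a + b)\<close>. Permitting a small step
  towards \<open>m\<close> is what exploits a gap of \<open>\<rho>\<close> around \<open>m\<close>; a purely outward transport would gain nothing
  from it.
\<close>

section \<open>Quantile maps\<close>

text \<open>The left-continuous generalized inverse. It is meaningful only at levels that
  \<open>K\<close> reaches and also falls below; elsewhere the set is empty or unbounded
  below.\<close>

definition quantile :: "(real \<Rightarrow> real) \<Rightarrow> real \<Rightarrow> real" where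
  "quantile K s = Inf {x. s \<le> K x}"

text \<open>Continuity makes the superlevel set closed, so its infimum belongs to it. The resulting
  Galois connection replaces all later dealings with \<open>Inf\<close>.\<close>

lemma quantile_le_iff:
  assumes "mono K" and cont: "continuous_on UNIV K" and "\<exists>x. s \<le> K x" and "\<exists>x. K x < s"
  shows "quantile K s \<le> x \<longleftrightarrow> s \<le> K x"
proof -
  let ?S = "{x. s \<le> K x}"
  obtain l where l: "K l < s" using assms(4) by blast
  have lb: "l \<le> x" if "x \<in> ?S" for x
    using that l monoD[OF \<open>mono K\<close>, of x l] by (cases "x \<le> l") auto
  have bdd: "bdd_below ?S" using lb by (rule bdd_belowI)
  have "closed ?S" using cont by (intro closed_Collect_le) auto
  with bdd assms(3) have "quantile K s \<in> ?S"
    unfolding quantile_def by (intro closed_contains_Inf) auto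
  then show ?thesis
    using monoD[OF \<open>mono K\<close>, of "quantile K s" x] cInf_lower[OF _ bdd, of x]
    by (auto simp: quantile_def)
qed

text \<open>Open at both ends, since the levels -1/2 and 1/2 may be attained only at infinity. The
  centring puts the median at level 0 and turns reflection of the line into a change of
  sign.\<close>

abbreviation unit_mass :: "real measure" where
  "unit_mass \<equiv> restrict_space lborel {-(1/2)<..<1/2}"

text \<open>Stands for the distribution function, lowered by 1/2, of an atomless probability
  measure; the last two assumptions encode its limits at infinity.\<close>

locale spread =
  fixes K :: "real \<Rightarrow> real"
  assumes mono_K: "mono K" and cont_K: "continuous_on UNIV K"
    and abs_K: "\<bar>K x\<bar> \<le> 1/2"
    and upper_K: "\<bar>s\<bar> < 1/2 \<Longrightarrow> \<exists>x. s \<le> K x" and lower_K: "\<bar>s\<bar> < 1/2 \<Longrightarrow> \<exists>x. K x < s"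
begin

lemma quantile_le: "\<bar>s\<bar> < 1/2 \<Longrightarrow> quantile K s \<le> x \<longleftrightarrow> s \<le> K x"
  by (rule quantile_le_iff[OF mono_K cont_K upper_K lower_K])

text \<open>A continuous \<open>K\<close> skips no level: the intermediate value theorem gives a
  point of value \<open>s\<close> at or before the quantile, which cannot lie strictly before
  it.\<close>

lemma K_quantile:
  assumes "\<bar>s\<bar> < 1/2"
  shows "K (quantile K s) = s"
proof (rule antisym)
  show "s \<le> K (quantile K s)" using quantile_le[OF assms] by blast
  obtain l where l: "K l < s" using lower_K[OF assms] by blast
  have "l \<le> quantile K s" using quantile_le[OF assms, of l] l by linarith
  with l \<open>s \<le> K (quantile K s)\<close> obtain x where x: "x \<le> quantile K s" "K x = s"
    using IVT'[of K l s "quantile K s"] cont_K continuous_on_subset by (metis less_imp_le subset_UNIV)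
  then show "K (quantile K s) \<le> s" using quantile_le[OF assms, of x] by simp
qed

lemma quantile_measurable [measurable]: "quantile K \<in> unit_mass \<rightarrow>\<^sub>M borel"
proof -
  have "mono_on {-(1/2)<..<1/2} (quantile K)"
  proof (rule mono_onI)
    fix r s :: real assume a: "r \<in> {-(1/2)<..<1/2}" "s \<in> {-(1/2)<..<1/2}" "r \<le> s"
    then have "\<bar>r\<bar> < 1/2" "\<bar>s\<bar> < 1/2" by auto
    with quantile_le[of r "quantile K s"] quantile_le[of s "quantile K s"] \<open>r \<le> s\<close>
    show "quantile K r \<le> quantile K s" by simp
  qed
  from borel_measurable_mono_on_fnc[OF this] show ?thesis
    by (simp cong: measurable_cong_sets sets_restrict_space_cong)
qed

text \<open>By \<open>quantile_le\<close> the preimage consists of the levels in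
  \<open>{K a<..K b}\<close>. Restricting to open levels loses at most the level \<open>K b\<close>,
  namely when it equals 1/2.\<close>

lemma quantile_Ioc:
  assumes "a \<le> b"
  shows "emeasure (distr unit_mass borel (quantile K)) {a<..b} = ennreal (K b - K a)"
proof -
  have "quantile K -` {a<..b} \<inter> {-(1/2)<..<1/2} = {K a<..K b} \<inter> {-(1/2)<..<1/2}"
  proof -
    have "quantile K s \<le> b \<longleftrightarrow> s \<le> K b" "quantile K s \<le> a \<longleftrightarrow> s \<le> K a"
      if "s \<in> {-(1/2)<..<1/2}" for s using that quantile_le[of s] by (auto simp: abs_less_iff)
    then show ?thesis by (auto simp: not_le[symmetric])
  qed
  then have "emeasure (distr unit_mass borel (quantile K)) {a<..b} = emeasure lborel ({K a<..K b} \<inter> {-(1/2)<..<1/2})"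
    by (simp add: emeasure_distr emeasure_restrict_space space_restrict_space)
  also have "\<dots> = emeasure lborel {K a<..K b}"
  proof (rule emeasure_eq_AE)
    have "AE x in lborel. x \<noteq> K b" by (rule AE_lborel_singleton)
    then show "AE x in lborel. x \<in> {K a<..K b} \<inter> {-(1/2)<..<1/2} \<longleftrightarrow> x \<in> {K a<..K b}"
    proof eventually_elim
      case (elim x) then show ?case using abs_K[of a] abs_K[of b] by auto
    qed
  qed auto
  also have "\<dots> = ennreal (K b - K a)" using monoD[OF mono_K assms] by simp
  finally show ?thesis .
qed

lemma quantile_Ioi: "emeasure (distr unit_mass borel (quantile K)) {a<..} = ennreal (1/2 - K a)"
proof -
  have "quantile K s \<le> a \<longleftrightarrow> s \<le> K a" if "s \<in> {-(1/2)<..<1/2}" for s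
    using that quantile_le[of s] by (auto simp: abs_less_iff)
  then have "quantile K -` {a<..} \<inter> {-(1/2)<..<1/2} = {K a<..<1/2}"
    using abs_K[of a] by (fastforce simp: not_le[symmetric] abs_le_iff)
  then have "emeasure (distr unit_mass borel (quantile K)) {a<..} = emeasure lborel {K a<..<1/2}"
    using abs_K[of a] by (simp add: emeasure_distr space_restrict_space) (subst emeasure_restrict_space, auto simp: abs_le_iff)
  also have "\<dots> = ennreal (1/2 - K a)" using abs_K[of a] by simp
  finally show ?thesis .
qed

end

section \<open>Splitting Lebesgue measure into three measures\<close>

lemma emeasure_Ioo_of_Ioc:
  fixes K :: "real \<Rightarrow> real"
  assumes sets: "sets M = sets borel" and cont: "continuous_on UNIV K" and "a \<le> b"
    and Ioc: "\<And>b. a \<le> b \<Longrightarrow> emeasure M {a<..b} = ennreal (K b - K a)"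
  shows "emeasure M {a<..<b} = ennreal (K b - K a)"
proof (cases "a = b")
  case False
  with \<open>a \<le> b\<close> have "a < b" by simp
  \<comment> \<open>\<open>u\<close> increases from \<open>a\<close> towards \<open>b\<close>
    without reaching it, so the half-open intervals exhaust the open one.\<close>
  define u where "u n = b - (b - a) / real (Suc n)" for n
  have le: "a \<le> u n" "u n < b" for n
  proof -
    have "(b - a) / real (Suc n) \<le> (b - a) / 1" using \<open>a < b\<close> by (intro divide_left_mono) auto
    then show "a \<le> u n" by (simp add: u_def)
    show "u n < b" using \<open>a < b\<close> by (simp add: u_def)
  qed
  have "(\<lambda>n. (b - a) * inverse (real (Suc n))) \<longlonglongrightarrow> (b - a) * 0"
    by (intro tendsto_mult tendsto_const LIMSEQ_inverse_real_of_nat)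
  then have u: "u \<longlonglongrightarrow> b"
    unfolding u_def divide_inverse using tendsto_diff[OF tendsto_const] by fastforce
  have "(\<lambda>n. emeasure M {a<..u n}) \<longlonglongrightarrow> emeasure M (\<Union>n. {a<..u n})"
  proof (rule Lim_emeasure_incseq)
    have "u i \<le> u j" if "i \<le> j" for i j
      unfolding u_def using \<open>a < b\<close> that by (intro diff_left_mono divide_left_mono) auto
    then show "incseq (\<lambda>n. {a<..u n})"
      by (intro monoI) (meson atMost_iff greaterThanAtMost_iff order_trans subsetI)
  qed (auto simp: sets)
  also have "(\<Union>n. {a<..u n}) = {a<..<b}"
  proof -
    have "\<exists>n. x \<le> u n" if "x < b" for x
    proof -
      have "eventually (\<lambda>n. x < u n) sequentially" using order_tendstoD(1)[OF u that] .
      then show ?thesis by (auto simp: eventually_sequentially intro: less_imp_le)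
    qed
    then show ?thesis using le by (fastforce intro: le_less_trans)
  qed
  finally have "(\<lambda>n. ennreal (K (u n) - K a)) \<longlonglongrightarrow> emeasure M {a<..<b}" using Ioc[OF le(1)] by simp
  moreover have "(\<lambda>n. K (u n)) \<longlonglongrightarrow> K b"
    by (rule continuous_on_tendsto_compose[OF cont u]) auto
  then have "(\<lambda>n. ennreal (K (u n) - K a)) \<longlonglongrightarrow> ennreal (K b - K a)"
    by (intro tendsto_ennrealI tendsto_diff tendsto_const)
  ultimately show ?thesis by (rule LIMSEQ_unique)
qed simp

text \<open>\<open>lborel\<close> is determined by its values on boxes, here open intervals, and
  there the three increments add up to the length. In the application the summands are the density,
  the competitor and the space left free by both.\<close>

lemma lborel_sum_three:
  fixes K1 K2 K3 :: "real \<Rightarrow> real"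
  assumes sets: "sets M1 = sets borel" "sets M2 = sets borel" "sets M3 = sets borel"
    and cont: "continuous_on UNIV K1" "continuous_on UNIV K2" "continuous_on UNIV K3"
    and mono: "mono K1" "mono K2" "mono K3"
    and Ioc: "\<And>a b. a \<le> b \<Longrightarrow> emeasure M1 {a<..b} = ennreal (K1 b - K1 a)"
      "\<And>a b. a \<le> b \<Longrightarrow> emeasure M2 {a<..b} = ennreal (K2 b - K2 a)"
      "\<And>a b. a \<le> b \<Longrightarrow> emeasure M3 {a<..b} = ennreal (K3 b - K3 a)"
    and total: "\<And>x. K1 x + K2 x + K3 x = x"
    and A: "A \<in> sets borel"
  shows "emeasure lborel A = emeasure M1 A + emeasure M2 A + emeasure M3 A"
proof -
  define \<mu> where "\<mu> A = emeasure M1 A + emeasure M2 A + emeasure M3 A" for A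
  define M where "M = measure_of UNIV (sets borel) \<mu>"
  have sM: "sets M = sets borel"
    unfolding M_def using sets.sigma_sets_eq[of "borel :: real measure"] by simp
  have eM: "emeasure M B = \<mu> B" if "B \<in> sets borel" for B
  proof (rule emeasure_measure_of[OF M_def])
    show "positive (sets M) \<mu>" by (simp add: positive_def \<mu>_def)
    show "countably_additive (sets M) \<mu>"
      unfolding countably_additive_def sM
    proof (intro allI impI)
      fix B :: "nat \<Rightarrow> real set"
      assume B: "range B \<subseteq> sets borel" "disjoint_family B"
      then have "(\<Sum>i. emeasure N (B i)) = emeasure N (\<Union>i. B i)" if "sets N = sets borel" for N
        using that by (intro suminf_emeasure) auto
      then show "(\<Sum>i. \<mu> (B i)) = \<mu> (\<Union>i. B i)"
        unfolding \<mu>_def using sets by (simp add: suminf_add[symmetric])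
    qed
  qed (use that sM in auto)
  have "lborel = M"
  proof (rule lborel_eqI)
    fix l u :: real assume "\<And>b. b \<in> Basis \<Longrightarrow> l \<bullet> b \<le> u \<bullet> b"
    then have lu: "l \<le> u" by simp
    have "emeasure M (box l u) = \<mu> {l<..<u}" by (simp add: eM box_real)
    also have "\<dots> = ennreal (K1 u - K1 l) + ennreal (K2 u - K2 l) + ennreal (K3 u - K3 l)"
      unfolding \<mu>_def
      using emeasure_Ioo_of_Ioc[OF sets(1) cont(1) lu Ioc(1)] emeasure_Ioo_of_Ioc[OF sets(2) cont(2) lu Ioc(2)]
        emeasure_Ioo_of_Ioc[OF sets(3) cont(3) lu Ioc(3)] by simp
    also have "\<dots> = ennreal (u - l)"
      using mono[THEN monoD, OF lu] total[of u] total[of l]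
      by (simp add: ennreal_plus[symmetric] algebra_simps del: ennreal_plus)
    finally show "emeasure M (box l u) = (\<Prod>b\<in>Basis. (u - l) \<bullet> b)" by simp
  qed (rule sM)
  then show ?thesis using eM[OF A] by (simp add: \<mu>_def)
qed

text \<open>
  Exhibiting three measures with sum \<open>lborel\<close> yields both absolute continuity and the pointwise bound
  on the densities.
\<close>

lemma complementary_density:
  fixes f :: "real \<Rightarrow> ennreal"
  assumes sets: "sets \<nu> = sets borel" "sets \<kappa> = sets borel"
    and [measurable]: "f \<in> borel_measurable borel"
    and total: "\<And>A. A \<in> sets borel \<Longrightarrow> emeasure lborel A = emeasure (density lborel f) A + emeasure \<nu> A + emeasure \<kappa> A"
  shows "\<exists>g\<in>borel_measurable borel. \<nu> = density lborel g \<and> (AE x in lborel. f x + g x \<le> 1)"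
proof -
  have ac: "absolutely_continuous lborel \<nu>" "absolutely_continuous lborel \<kappa>"
    unfolding absolutely_continuous_def using total sets by (auto simp: null_sets_def)
  obtain g where [measurable]: "g \<in> borel_measurable borel" and g: "density lborel g = \<nu>"
    using sigma_finite_measure.Radon_Nikodym[OF sigma_finite_lborel ac(1)] sets by auto
  obtain h where [measurable]: "h \<in> borel_measurable borel" and h: "density lborel h = \<kappa>"
    using sigma_finite_measure.Radon_Nikodym[OF sigma_finite_lborel ac(2)] sets by auto
  have "density lborel (\<lambda>x. f x + g x + h x) = density lborel (\<lambda>x. 1)"
  proof (rule measure_eqI)
    fix A assume "A \<in> sets (density lborel (\<lambda>x. f x + g x + h x))"
    then have [measurable]: "A \<in> sets borel" by simp
    have "emeasure (density lborel (\<lambda>x. f x + g x + h x)) A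
        = (\<integral>\<^sup>+x. f x * indicator A x + g x * indicator A x + h x * indicator A x \<partial>lborel)"
      by (simp add: emeasure_density algebra_simps)
    also have "\<dots> = emeasure (density lborel f) A + emeasure \<nu> A + emeasure \<kappa> A"
      unfolding g[symmetric] h[symmetric] by (simp add: nn_integral_add emeasure_density)
    finally show "emeasure (density lborel (\<lambda>x. f x + g x + h x)) A = emeasure (density lborel (\<lambda>x. 1)) A"
      using total[of A] by (simp add: emeasure_density)
  qed simp
  then have "AE x in lborel. f x + g x + h x = 1"
    by (intro sigma_finite_measure.density_unique[OF sigma_finite_lborel]) simp_all
  then have "AE x in lborel. f x + g x \<le> 1"
    by eventually_elim (metis le_iff_add)
  then show ?thesis using g by (intro bexI[of _ g]) auto
qed

section \<open>Greedy filling of the free space\<close>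

lemma continuous_of_increments:
  fixes f :: "real \<Rightarrow> real"
  assumes mono: "\<And>a b. a \<le> b \<Longrightarrow> f a \<le> f b" and lip: "\<And>a b. a \<le> b \<Longrightarrow> f b - f a \<le> b - a"
  shows "continuous_on UNIV f"
proof (rule continuous_onI)
  fix x e :: real assume "0 < e"
  have "dist (f y) (f x) \<le> dist y x" for y
  proof (cases "x \<le> y")
    case True
    with mono[OF True] lip[OF True] show ?thesis by (simp add: dist_real_def)
  next
    case False
    with mono[of y x] lip[of y x] show ?thesis by (simp add: dist_real_def)
  qed
  then show "\<exists>d>0. \<forall>y\<in>UNIV. dist y x < d \<longrightarrow> dist (f y) (f x) \<le> e"
    using \<open>0 < e\<close> by (meson less_imp_le order_trans)
qed

text \<open>When \<Phi> measures the mass from \<open>m\<close> on, this is the free volume between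
  \<open>m\<close> and \<open>x\<close> for \<open>m \<le> x\<close>, and its negative for
  \<open>x \<le> m\<close>.\<close>

definition gap :: "(real \<Rightarrow> real) \<Rightarrow> real \<Rightarrow> real \<Rightarrow> real" where
  "gap \<Phi> m x = x - m - \<Phi> x"

text \<open>
  The mass of the greedily filled places in \<open>(m, X]\<close>: up to \<open>z\<close> only the mass in \<open>(m, z + 1/4]\<close> is
  available, and between \<open>z\<close> and \<open>X\<close> at most the free volume can be filled.
\<close>

definition fill :: "(real \<Rightarrow> real) \<Rightarrow> real \<Rightarrow> real \<Rightarrow> real" where
  "fill \<Phi> m X = (INF z\<in>{..X}. max 0 (\<Phi> (z + 1/4)) + max 0 (gap \<Phi> m X) - max 0 (gap \<Phi> m z))"

locale half_cdf =
  fixes \<Phi> :: "real \<Rightarrow> real" and m :: real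
  assumes mono_\<Phi>: "a \<le> b \<Longrightarrow> \<Phi> a \<le> \<Phi> b" and lip_\<Phi>: "a \<le> b \<Longrightarrow> \<Phi> b - \<Phi> a \<le> b - a"
    and median: "\<Phi> m = 0" and abs_\<Phi>: "\<bar>\<Phi> x\<bar> \<le> 1/2"
begin

text \<open>The mirror image of the configuration. Through it, facts about filling to the right of
  \<open>m\<close> also serve on the left.\<close>

lemma reflect: "half_cdf (\<lambda>x. - \<Phi> (- x)) (- m)"
proof
  show "- \<Phi> (- b) - - \<Phi> (- a) \<le> b - a" if "a \<le> b" for a b
    using lip_\<Phi>[of "-b" "-a"] that by simp
qed (use mono_\<Phi> median abs_\<Phi> in auto)

lemma gap_mono: "a \<le> b \<Longrightarrow> gap \<Phi> m a \<le> gap \<Phi> m b"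
  using lip_\<Phi>[of a b] by (simp add: gap_def)

lemma pos_gap_mono: "a \<le> b \<Longrightarrow> max 0 (gap \<Phi> m a) \<le> max 0 (gap \<Phi> m b)"
  using gap_mono[of a b] by simp

lemma fill_le:
  assumes "z \<le> X"
  shows "fill \<Phi> m X \<le> max 0 (\<Phi> (z + 1/4)) + max 0 (gap \<Phi> m X) - max 0 (gap \<Phi> m z)"
  unfolding fill_def
proof (rule cINF_lower)
  show "bdd_below ((\<lambda>z. max 0 (\<Phi> (z + 1/4)) + max 0 (gap \<Phi> m X) - max 0 (gap \<Phi> m z)) ` {..X})"
  proof (rule bdd_belowI2)
    show "0 \<le> max 0 (\<Phi> (z + 1/4)) + max 0 (gap \<Phi> m X) - max 0 (gap \<Phi> m z)" if "z \<in> {..X}" for z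
      using pos_gap_mono[of z X] that by simp
  qed
qed (use assms in auto)

lemma fill_greatest:
  assumes "\<And>z. z \<le> X \<Longrightarrow> c \<le> max 0 (\<Phi> (z + 1/4)) + max 0 (gap \<Phi> m X) - max 0 (gap \<Phi> m z)"
  shows "c \<le> fill \<Phi> m X"
  unfolding fill_def using assms by (intro cINF_greatest) auto

lemma fill_nonneg: "0 \<le> fill \<Phi> m X"
  by (rule fill_greatest) (use pos_gap_mono in \<open>simp add: add_increasing\<close>)

lemma fill_le_arrived: "fill \<Phi> m X \<le> max 0 (\<Phi> (X + 1/4))"
  using fill_le[of X X] by simp

lemma fill_eq_0:
  assumes "X \<le> m"
  shows "fill \<Phi> m X = 0"
proof (rule antisym[OF _ fill_nonneg])
  \<comment> \<open>At this \<open>z\<close> no mass beyond \<open>m\<close> is available yet, even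
    with the advance of 1/4, and places up to \<open>m\<close> offer no room.\<close>
  let ?z = "min X (m - 1/4)"
  have "\<Phi> (?z + 1/4) \<le> 0" using mono_\<Phi>[of "?z + 1/4" m] median by simp
  moreover have "gap \<Phi> m X \<le> 0" using gap_mono[OF assms] by (simp add: gap_def median)
  ultimately show "fill \<Phi> m X \<le> 0" using fill_le[of ?z X] by simp
qed

lemma fill_mono:
  assumes "X \<le> Y"
  shows "fill \<Phi> m X \<le> fill \<Phi> m Y"
proof (rule fill_greatest)
  fix z assume "z \<le> Y"
  show "fill \<Phi> m X \<le> max 0 (\<Phi> (z + 1/4)) + max 0 (gap \<Phi> m Y) - max 0 (gap \<Phi> m z)"
  proof (cases "z \<le> X")
    case True
    show ?thesis using fill_le[OF True] pos_gap_mono[OF assms] by linarith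
  next
    case False
    then have "\<Phi> (X + 1/4) \<le> \<Phi> (z + 1/4)" by (intro mono_\<Phi>) simp
    then show ?thesis using fill_le_arrived[of X] pos_gap_mono[OF \<open>z \<le> Y\<close>] by linarith
  qed
qed

text \<open>Every \<open>z\<close> admissible for \<open>X\<close> is admissible for
  \<open>Y\<close> and changes only the free volume term. This bound is what makes the filling fit
  into the space left by the density.\<close>

lemma fill_increment:
  assumes "X \<le> Y"
  shows "fill \<Phi> m Y - fill \<Phi> m X \<le> max 0 (gap \<Phi> m Y) - max 0 (gap \<Phi> m X)"
proof -
  have "fill \<Phi> m Y - (max 0 (gap \<Phi> m Y) - max 0 (gap \<Phi> m X)) \<le> fill \<Phi> m X"
  proof (rule fill_greatest)
    fix z assume "z \<le> X"
    then show "fill \<Phi> m Y - (max 0 (gap \<Phi> m Y) - max 0 (gap \<Phi> m X))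
        \<le> max 0 (\<Phi> (z + 1/4)) + max 0 (gap \<Phi> m X) - max 0 (gap \<Phi> m z)"
      using fill_le[of z Y] assms by linarith
  qed
  then show ?thesis by linarith
qed

text \<open>Each \<open>z\<close> in the infimum is checked. From \<open>x - 1/4\<close> on, all
  mass up to \<open>x\<close> is available. Between \<open>m\<close> and there, the first entry of
  the maximum leaves enough room. Before \<open>m\<close>, the second entry provides free volume at
  least \<open>\<Phi> x\<close>.\<close>

lemma fill_reach:
  assumes "m \<le> x"
  shows "\<Phi> x \<le> fill \<Phi> m (max (x + 1/4) (m + 1/2 + \<Phi> x))" (is "_ \<le> fill \<Phi> m ?X")
proof (rule fill_greatest)
  fix z assume z: "z \<le> ?X"
  have X: "\<Phi> ?X \<le> 1/2" using abs_\<Phi>[of ?X] by linarith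
  consider "x - 1/4 \<le> z" | "z < x - 1/4" "m \<le> z" | "z < m" by linarith
  then show "\<Phi> x \<le> max 0 (\<Phi> (z + 1/4)) + max 0 (gap \<Phi> m ?X) - max 0 (gap \<Phi> m z)"
  proof cases
    case 1
    then show ?thesis using mono_\<Phi>[of x "z + 1/4"] pos_gap_mono[OF z] by linarith
  next
    case 2
    \<comment> \<open>One side carries mass at most 1/2, so the free volume between \<open>z\<close>
      and \<open>?X\<close> is at least \<open>(x + 1/4 - z) - 1/2\<close>. This is
      \<open>x - (z + 1/4)\<close>, which bounds the mass not yet available. Hence the choice 1/4:
      advance and delay add up to 1/2.\<close>
    have "0 \<le> gap \<Phi> m z" "0 \<le> \<Phi> z"
      using gap_mono[OF 2(2)] mono_\<Phi>[OF 2(2)] by (auto simp: gap_def median)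
    moreover have "\<Phi> x - \<Phi> (z + 1/4) \<le> x - (z + 1/4)" using 2 by (intro lip_\<Phi>) simp
    ultimately show ?thesis using X max.cobounded1[of "x + 1/4" "m + 1/2 + \<Phi> x"]
      by (simp add: gap_def)
  next
    case 3
    then have "gap \<Phi> m z \<le> 0" using gap_mono[of z m] by (simp add: gap_def median)
    moreover have "\<Phi> x \<le> gap \<Phi> m ?X" using X by (simp add: gap_def)
    ultimately show ?thesis by linarith
  qed
qed

end

section \<open>The two sides joined to one target distribution\<close>

definition target_cdf :: "(real \<Rightarrow> real) \<Rightarrow> real \<Rightarrow> real \<Rightarrow> real" where
  "target_cdf \<Phi> m X = fill \<Phi> m X - fill (\<lambda>x. - \<Phi> (- x)) (- m) (- X)"

context half_cdf
begin

interpretation R: half_cdf "\<lambda>x. - \<Phi> (- x)" "- m" by (rule reflect)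

lemma target_mono: "mono (target_cdf \<Phi> m)"
  unfolding target_cdf_def by (intro monoI diff_mono fill_mono R.fill_mono) auto

text \<open>The one-sided fillings use up the positive and the negative part of \<open>gap\<close>,
  and the bounds on their increments add up to the increment of \<open>gap\<close> itself.\<close>

lemma target_increment:
  assumes "a \<le> b"
  shows "target_cdf \<Phi> m b - target_cdf \<Phi> m a \<le> gap \<Phi> m b - gap \<Phi> m a"
proof -
  have "gap (\<lambda>x. - \<Phi> (- x)) (- m) (- x) = - gap \<Phi> m x" for x by (simp add: gap_def)
  then show ?thesis
    using fill_increment[OF assms] R.fill_increment[of "-b" "-a"] assms
    unfolding target_cdf_def by (simp add: max_def split: if_splits)
qed

text \<open>\<open>target_le\<close> and \<open>target_ge\<close> will limit steps towards
  \<open>m\<close> to 1/4; \<open>target_reach_right\<close> and \<open>target_reach_left\<close>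
  will limit the outward steps.\<close>

lemma target_le: "target_cdf \<Phi> m X \<le> max 0 (\<Phi> (X + 1/4))"
  using fill_le_arrived[of X] R.fill_nonneg[of "-X"] unfolding target_cdf_def by linarith

lemma target_ge: "min 0 (\<Phi> (X - 1/4)) \<le> target_cdf \<Phi> m X"
  using R.fill_le_arrived[of "-X"] fill_nonneg[of X] unfolding target_cdf_def
  by (simp add: max_def min_def split: if_splits)

lemma target_abs: "\<bar>target_cdf \<Phi> m X\<bar> \<le> 1/2"
  using target_le[of X] target_ge[of X] abs_\<Phi>[of "X + 1/4"] abs_\<Phi>[of "X - 1/4"] by linarith

lemma target_reach_right:
  assumes "m \<le> x"
  shows "\<Phi> x \<le> target_cdf \<Phi> m (max (x + 1/4) (m + 1/2 + \<Phi> x))"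
  using fill_reach[OF assms] R.fill_eq_0[of "- max (x + 1/4) (m + 1/2 + \<Phi> x)"] assms
  unfolding target_cdf_def by simp

lemma target_reach_left:
  assumes "x \<le> m"
  shows "target_cdf \<Phi> m (min (x - 1/4) (m - 1/2 + \<Phi> x)) \<le> \<Phi> x"
proof -
  have "- min (x - 1/4) (m - 1/2 + \<Phi> x) = max (- x + 1/4) (- m + 1/2 + - \<Phi> (- (- x)))"
    by (simp add: min_def max_def)
  then show ?thesis
    using R.fill_reach[of "-x"] fill_eq_0[of "min (x - 1/4) (m - 1/2 + \<Phi> x)"] assms
    unfolding target_cdf_def by simp
qed

lemma target_continuous: "continuous_on UNIV (target_cdf \<Phi> m)"
proof (rule continuous_of_increments)
  fix a b :: real assume "a \<le> b"
  then show "target_cdf \<Phi> m b - target_cdf \<Phi> m a \<le> b - a"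
    using target_increment[of a b] mono_\<Phi>[of a b] by (simp add: gap_def)
qed (rule target_mono[THEN monoD])

end

section \<open>Displacement under the quantile maps\<close>

locale half_cdf_spread = half_cdf \<Phi> m + spread \<Phi> for \<Phi> m
begin

sublocale T: spread "target_cdf \<Phi> m"
proof
  show "\<exists>x. s \<le> target_cdf \<Phi> m x" if "\<bar>s\<bar> < 1/2" for s
  proof -
    from that have "\<bar>max s 0\<bar> < 1/2" by simp
    from upper_K[OF this] obtain x where x: "max s 0 \<le> \<Phi> x" by blast
    have "\<Phi> x \<le> \<Phi> (max x m)" by (rule mono_\<Phi>) simp
    with x target_reach_right[of "max x m"] show ?thesis
      by (meson max.bounded_iff max.cobounded2 order_trans)
  qed
  show "\<exists>x. target_cdf \<Phi> m x < s" if "\<bar>s\<bar> < 1/2" for s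
  proof -
    \<comment> \<open>A value of \<Phi> below 0 forces \<open>x\<close> to the left of
      \<open>m\<close>, where \<open>target_reach_left\<close> applies.\<close>
    from that have "\<bar>min s 0\<bar> < 1/2" by simp
    from lower_K[OF this] obtain x where x: "\<Phi> x < min s 0" by blast
    then have "x \<le> m" using mono_\<Phi>[of m x] median by force
    from target_reach_left[OF this] x show ?thesis by (meson le_less_trans min_less_iff_conj)
  qed
qed (rule target_mono target_continuous target_abs)+

lemma displacement_right:
  assumes "0 < s" "s < 1/2"
  shows "quantile \<Phi> s - 1/4 \<le> quantile (target_cdf \<Phi> m) s"
    and "quantile (target_cdf \<Phi> m) s \<le> max (quantile \<Phi> s + 1/4) (m + 1/2 + s)"
proof -
  let ?x = "quantile \<Phi> s" and ?y = "quantile (target_cdf \<Phi> m) s"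
  have s: "\<bar>s\<bar> < 1/2" using assms by simp
  have "s \<le> max 0 (\<Phi> (?y + 1/4))" using T.K_quantile[OF s] target_le[of ?y] by simp
  then show "?x - 1/4 \<le> ?y" using quantile_le[OF s, of "?y + 1/4"] assms by linarith
  have "m \<le> ?x" using quantile_le[OF s, of m] median assms by linarith
  from target_reach_right[OF this] show "?y \<le> max (?x + 1/4) (m + 1/2 + s)"
    using K_quantile[OF s] T.quantile_le[OF s] by simp
qed

lemma displacement_left:
  assumes "- (1/2) < s" "s < 0"
  shows "quantile (target_cdf \<Phi> m) s \<le> quantile \<Phi> s + 1/4"
    and "min (quantile \<Phi> s - 1/4) (m - 1/2 + s) \<le> quantile (target_cdf \<Phi> m) s"
proof -
  let ?x = "quantile \<Phi> s" and ?y = "quantile (target_cdf \<Phi> m) s"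
  have s: "\<bar>s\<bar> < 1/2" using assms by simp
  have "s \<le> target_cdf \<Phi> m (?x + 1/4)"
    using target_ge[of "?x + 1/4"] K_quantile[OF s] assms by simp
  then show "?y \<le> ?x + 1/4" using T.quantile_le[OF s] by simp
  \<comment> \<open>\<open>quantile\<close> takes the left end of a level set, so reflection does
    not carry the bound over from the right. Instead, if the bound fails by \<open>d\<close>, then
    at distance \<open>d\<close> to the left of \<open>?x\<close> the value of \<Phi> is below
    \<open>s\<close>, but by at most \<open>d\<close>; this forces the target below \<open>s\<close>
    at its own quantile.\<close>
  show "min (?x - 1/4) (m - 1/2 + s) \<le> ?y"
  proof (rule ccontr)
    assume less: "\<not> ?thesis"
    define d where "d = min (?x - 1/4) (m - 1/2 + s) - ?y"
    define x where "x = ?x - d"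
    have "d > 0" using less by (simp add: d_def not_le)
    have "\<not> s \<le> \<Phi> x" using quantile_le[OF s, of x] \<open>d > 0\<close> by (simp add: x_def)
    then have "\<Phi> x < s" by simp
    have "x \<le> m" using mono_\<Phi>[of m x] median \<open>\<Phi> x < s\<close> assms by force
    have "s - d \<le> \<Phi> x" using lip_\<Phi>[of x ?x] K_quantile[OF s] \<open>d > 0\<close> by (simp add: x_def)
    then have "?y \<le> min (x - 1/4) (m - 1/2 + \<Phi> x)" unfolding x_def d_def by linarith
    then have "target_cdf \<Phi> m ?y \<le> \<Phi> x"
      using target_reach_left[OF \<open>x \<le> m\<close>] monoD[OF target_mono] order_trans by blast
    then show False using T.K_quantile[OF s] \<open>\<Phi> x < s\<close> by simp
  qed
qed

end

section \<open>Cost of the coupling by quantiles\<close>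

lemma powr_le_linear_gain:
  fixes D a p :: real
  assumes "0 \<le> D" "D \<le> (1/2) * (1 - a)" "0 \<le> a" "a \<le> 1" "1 \<le> p"
  shows "D powr p \<le> (1/2) powr p * (1 - a)"
proof -
  have "D powr p \<le> ((1/2) * (1 - a)) powr p" using assms by (intro powr_mono2) simp_all
  also have "\<dots> = (1/2) powr p * (1 - a) powr p" by (rule powr_mult)
  \<comment> \<open>A relative saving \<open>a\<close> in distance is at least a relative saving
    \<open>a\<close> in cost.\<close>
  also have "(1 - a) powr p \<le> 1 - a"
    using assms powr_le_one_le[of "1 - a" p] by (cases "a = 1") auto
  finally show ?thesis by simp
qed

context half_cdf_spread
begin

lemma median_bounds:
  "0 \<le> \<Phi> (m + 1/2)" "\<Phi> (m + 1/2) \<le> 1/2" "- (1/2) \<le> \<Phi> (m - 1/2)" "\<Phi> (m - 1/2) \<le> 0"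
  using mono_\<Phi>[of m "m + 1/2"] mono_\<Phi>[of "m - 1/2" m] median
    abs_\<Phi>[of "m + 1/2"] abs_\<Phi>[of "m - 1/2"] by auto

text \<open>Mass moves by at most the maximum of 1/4 and 1/2 minus the free volume between
  \<open>m\<close> and its starting point. Beyond distance 1/2 from \<open>m\<close> that volume is
  at least 1/2 minus the mass within this distance on the same side, hence the two refined bounds.
  Level 0 belongs to neither side.\<close>

lemma quantile_displacement:
  assumes "\<bar>s\<bar> < 1/2" "s \<noteq> 0"
  shows "\<bar>quantile \<Phi> s - quantile (target_cdf \<Phi> m) s\<bar> \<le> 1/2"
    and "\<Phi> (m + 1/2) < s \<Longrightarrow> \<bar>quantile \<Phi> s - quantile (target_cdf \<Phi> m) s\<bar> \<le> max (1/4) (\<Phi> (m + 1/2))"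
    and "s \<le> \<Phi> (m - 1/2) \<Longrightarrow> \<bar>quantile \<Phi> s - quantile (target_cdf \<Phi> m) s\<bar> \<le> max (1/4) (- \<Phi> (m - 1/2))"
proof -
  let ?x = "quantile \<Phi> s" and ?y = "quantile (target_cdf \<Phi> m) s"
  have x: "\<Phi> ?x = s" by (rule K_quantile[OF assms(1)])
  consider "0 < s" | "s < 0" using assms(2) by linarith
  note cases = this
  have right: "\<bar>?x - ?y\<bar> \<le> max (1/4) (1/2 - gap \<Phi> m ?x)" "m \<le> ?x" if "0 < s"
  proof -
    show "\<bar>?x - ?y\<bar> \<le> max (1/4) (1/2 - gap \<Phi> m ?x)"
      using displacement_right[of s] assms(1) that x unfolding gap_def by linarith
    show "m \<le> ?x" using quantile_le[OF assms(1), of m] median that by linarith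
  qed
  have left: "\<bar>?x - ?y\<bar> \<le> max (1/4) (1/2 + gap \<Phi> m ?x)" "?x \<le> m" if "s < 0"
  proof -
    show "\<bar>?x - ?y\<bar> \<le> max (1/4) (1/2 + gap \<Phi> m ?x)"
      using displacement_left[of s] assms(1) that x unfolding gap_def by linarith
    show "?x \<le> m" using quantile_le[OF assms(1), of m] median that by linarith
  qed
  have gap: "gap \<Phi> m m = 0" "gap \<Phi> m (m + 1/2) = 1/2 - \<Phi> (m + 1/2)"
    "gap \<Phi> m (m - 1/2) = - (1/2) - \<Phi> (m - 1/2)"
    by (auto simp: gap_def median)
  show "\<bar>?x - ?y\<bar> \<le> 1/2"
    using cases
  proof cases
    case 1
    then show ?thesis using right[OF 1] gap_mono[of m ?x] gap unfolding le_max_iff_disj by linarith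
  next
    case 2
    then show ?thesis using left[OF 2] gap_mono[of ?x m] gap unfolding le_max_iff_disj by linarith
  qed
  show "\<bar>?x - ?y\<bar> \<le> max (1/4) (\<Phi> (m + 1/2))" if "\<Phi> (m + 1/2) < s"
  proof -
    have "m + 1/2 \<le> ?x" using quantile_le[OF assms(1), of "m + 1/2"] that by linarith
    then show ?thesis using right gap_mono[of "m + 1/2" ?x] gap that median_bounds by auto
  qed
  show "\<bar>?x - ?y\<bar> \<le> max (1/4) (- \<Phi> (m - 1/2))" if "s \<le> \<Phi> (m - 1/2)"
  proof -
    have "?x \<le> m - 1/2" using quantile_le[OF assms(1), of "m - 1/2"] that by linarith
    then show ?thesis using left gap_mono[of ?x "m - 1/2"] gap that median_bounds assms by auto
  qed
qed

text \<open>Let \<open>a = 1/2 - r\<close> and \<open>b = 1/2 + l\<close> be the masses beyond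
  distance 1/2 from \<open>m\<close> on the right and on the left. They cost at most
  \<open>c * (1 - a)\<close> and \<open>c * (1 - b)\<close> per unit, the rest at most
  \<open>c\<close>, and the total mass is 1.\<close>

lemma quantile_cost:
  assumes "1 \<le> p"
  shows "(\<integral>\<^sup>+ s. ennreal (\<bar>quantile \<Phi> s - quantile (target_cdf \<Phi> m) s\<bar> powr p) \<partial>unit_mass)
    \<le> ennreal ((1/2) powr p * (1 - (1/2 - \<Phi> (m + 1/2))\<^sup>2 - (1/2 + \<Phi> (m - 1/2))\<^sup>2))"
    (is "(\<integral>\<^sup>+ s. ennreal (?D s powr p) \<partial>unit_mass) \<le> _")
proof -
  define c r l where "c = (1/2 :: real) powr p" and "r = \<Phi> (m + 1/2)" and "l = \<Phi> (m - 1/2)"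
  have rl: "0 \<le> r" "r \<le> 1/2" "- (1/2) \<le> l" "l \<le> 0"
    using median_bounds by (simp_all add: r_def l_def)
  have c: "0 \<le> c" by (simp add: c_def)
  let ?g = "\<lambda>s. ennreal c * indicator {l<..r} s + ennreal (c * (1 - (1/2 - r))) * indicator {r<..1/2} s
    + ennreal (c * (1 - (1/2 + l))) * indicator {-(1/2)<..l} s"
  have "(\<integral>\<^sup>+ s. ennreal (?D s powr p) \<partial>unit_mass)
      = (\<integral>\<^sup>+ s. ennreal (?D s powr p) * indicator {-(1/2)<..<1/2} s \<partial>lborel)"
    by (rule nn_integral_restrict_space) simp
  also have "\<dots> \<le> (\<integral>\<^sup>+ s. ?g s \<partial>lborel)"
  proof (rule nn_integral_mono_AE)
    have "AE s in lborel. s \<noteq> (0::real)" by (rule AE_lborel_singleton)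
    then show "AE s in lborel. ennreal (?D s powr p) * indicator {-(1/2)<..<1/2} s \<le> ?g s"
    proof eventually_elim
      case (elim s)
      show ?case
      proof (cases "\<bar>s\<bar> < 1/2")
        case True
        note D = quantile_displacement[OF True elim]
        consider "s \<le> l" | "l < s" "s \<le> r" | "r < s" by linarith
        then show ?thesis
        proof cases
          case 1
          \<comment> \<open>Since \<open>- (1/2) \<le> l \<le> 0\<close>, both \<open>1/4\<close>
            and \<open>- l\<close> are at most \<open>1/4 - l/2\<close>, which is
            \<open>(1/2) * (1 - (1/2 + l))\<close>. The third case is the same with \<open>r\<close>
            for \<open>- l\<close>.\<close>
          have "?D s powr p \<le> c * (1 - (1/2 + l))"
            unfolding c_def using D(3)[OF 1[unfolded l_def], folded l_def] rl assms
            unfolding le_max_iff_disj by (intro powr_le_linear_gain) auto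
          then show ?thesis using 1 rl True by (simp add: ennreal_leI)
        next
          case 2
          have "?D s powr p \<le> c * (1 - 0)"
            unfolding c_def using D(1) assms by (intro powr_le_linear_gain) auto
          then show ?thesis using 2 rl True by (simp add: ennreal_leI)
        next
          case 3
          have "?D s powr p \<le> c * (1 - (1/2 - r))"
            unfolding c_def using D(2)[OF 3[unfolded r_def], folded r_def] rl assms
            unfolding le_max_iff_disj by (intro powr_le_linear_gain) auto
          then show ?thesis using 3 rl True by (simp add: ennreal_leI)
        qed
      qed (auto simp: abs_less_iff indicator_def)
    qed
  qed
  also have "\<dots> = ennreal c * ennreal (r - l) + ennreal (c * (1 - (1/2 - r))) * ennreal (1/2 - r)
      + ennreal (c * (1 - (1/2 + l))) * ennreal (l + 1/2)"
    using rl by (simp add: nn_integral_add nn_integral_cmult_indicator)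
  also have "\<dots> = ennreal (c * (r - l) + c * (1 - (1/2 - r)) * (1/2 - r) + c * (1 - (1/2 + l)) * (l + 1/2))"
    using rl c by (simp add: ennreal_mult[symmetric] ennreal_plus[symmetric] del: ennreal_plus)
  also have "c * (r - l) + c * (1 - (1/2 - r)) * (1/2 - r) + c * (1 - (1/2 + l)) * (l + 1/2)
      = c * (1 - (1/2 - r)\<^sup>2 - (1/2 + l)\<^sup>2)"
    by (simp add: power2_eq_square algebra_simps)
  finally show ?thesis unfolding c_def r_def l_def .
qed

end

section \<open>The competitor of a density\<close>

lemma density_measure_distribution:
  assumes "\<rho> \<in> densities"
  shows "real_distribution (density_measure \<rho>)"
proof -
  from assms have [measurable]: "\<rho> \<in> borel_measurable borel" and int: "integrable lborel \<rho>"
    and nn: "AE x in lborel. 0 \<le> \<rho> x" and one: "(\<integral>x. \<rho> x \<partial>lborel) = 1"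
    by (auto simp: densities_def)
  have "emeasure (density_measure \<rho>) (space (density_measure \<rho>)) = (\<integral>\<^sup>+x. ennreal (\<rho> x) \<partial>lborel)"
    by (simp add: density_measure_def emeasure_density)
  also have "\<dots> = 1" using nn_integral_eq_integral[OF int nn] one by simp
  finally have "prob_space (density_measure \<rho>)" by (rule prob_spaceI)
  then show ?thesis
    by (simp add: real_distribution_def real_distribution_axioms_def density_measure_def)
qed

definition centred_cdf :: "(real \<Rightarrow> real) \<Rightarrow> real \<Rightarrow> real" where
  "centred_cdf \<rho> x = cdf (density_measure \<rho>) x - 1/2"

lemma centred_cdf_diff:
  assumes "\<rho> \<in> densities" "a \<le> b"
  shows "centred_cdf \<rho> b - centred_cdf \<rho> a = measure (density_measure \<rho>) {a<..b}"
proof -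
  interpret real_distribution "density_measure \<rho>" by (rule density_measure_distribution[OF assms(1)])
  show ?thesis using cdf_diff_eq[of a b] assms(2) by (cases "a = b") (auto simp: centred_cdf_def)
qed

text \<open>The constraint \<rho> \<le> 1 enters here; it yields both continuity and the Lipschitz
  assumption of \<open>half_cdf\<close>.\<close>

lemma centred_cdf_increment:
  assumes "\<rho> \<in> densities" "a \<le> b"
  shows "centred_cdf \<rho> b - centred_cdf \<rho> a \<le> b - a"
proof -
  interpret real_distribution "density_measure \<rho>" by (rule density_measure_distribution[OF assms(1)])
  from assms have [measurable]: "\<rho> \<in> borel_measurable borel" and le: "AE x in lborel. \<rho> x \<le> 1"
    by (auto simp: densities_def)
  have "ennreal (measure (density_measure \<rho>) {a<..b}) = emeasure (density_measure \<rho>) {a<..b}"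
    by (simp add: emeasure_eq_measure)
  also have "\<dots> = (\<integral>\<^sup>+x. ennreal (\<rho> x) * indicator {a<..b} x \<partial>lborel)"
    by (simp add: density_measure_def emeasure_density)
  also have "\<dots> \<le> (\<integral>\<^sup>+x. indicator {a<..b} x \<partial>lborel)"
    using le by (intro nn_integral_mono_AE) (auto elim!: eventually_mono simp: indicator_def ennreal_le_1)
  also have "\<dots> = ennreal (b - a)" using assms(2) by simp
  finally show ?thesis using centred_cdf_diff[OF assms] assms(2) by simp
qed

lemma centred_cdf_half_cdf_spread:
  assumes "\<rho> \<in> densities"
  shows "\<exists>m. half_cdf_spread (centred_cdf \<rho>) m"
proof -
  interpret real_distribution "density_measure \<rho>" by (rule density_measure_distribution[OF assms])
  have mono: "centred_cdf \<rho> a \<le> centred_cdf \<rho> b" if "a \<le> b" for a b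
    using cdf_nondecreasing[OF that] by (simp add: centred_cdf_def)
  have cont: "continuous_on UNIV (centred_cdf \<rho>)"
    by (rule continuous_of_increments[OF mono centred_cdf_increment[OF assms]])
  have upper: "\<exists>x. s \<le> centred_cdf \<rho> x" if "\<bar>s\<bar> < 1/2" for s
  proof -
    have "eventually (\<lambda>x. s + 1/2 < cdf (density_measure \<rho>) x) at_top"
      using that by (intro order_tendstoD(1)[OF cdf_lim_at_top_prob]) simp
    then obtain x where "s + 1/2 < cdf (density_measure \<rho>) x"
      by (auto simp: eventually_at_top_linorder)
    then show ?thesis by (intro exI[of _ x]) (simp add: centred_cdf_def)
  qed
  have lower: "\<exists>x. centred_cdf \<rho> x < s" if "\<bar>s\<bar> < 1/2" for s
  proof -
    have "eventually (\<lambda>x. cdf (density_measure \<rho>) x < s + 1/2) at_bot"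
      using that by (intro order_tendstoD(2)[OF cdf_lim_at_bot]) simp
    then obtain x where "cdf (density_measure \<rho>) x < s + 1/2"
      by (auto simp: eventually_at_bot_linorder)
    then show ?thesis by (intro exI[of _ x]) (simp add: centred_cdf_def)
  qed
  obtain u l where ul: "0 \<le> centred_cdf \<rho> u" "centred_cdf \<rho> l < 0"
    using upper[of 0] lower[of 0] by auto
  then have "l \<le> u" using mono[of u l] by linarith
  then obtain m where m: "centred_cdf \<rho> m = 0"
    using IVT'[of "centred_cdf \<rho>" l 0 u] ul continuous_on_subset[OF cont] by auto
  have "\<bar>centred_cdf \<rho> x\<bar> \<le> 1/2" for x
    using cdf_nonneg[of x] cdf_bounded_prob[of x] unfolding centred_cdf_def by linarith
  with m show ?thesis
    by (intro exI[of _ m] half_cdf_spread.intro half_cdf.intro spread.intro monoI mono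
        centred_cdf_increment[OF assms] cont upper lower)
qed

lemma distr_quantile_density:
  assumes "\<rho> \<in> densities" "spread (centred_cdf \<rho>)"
  shows "distr unit_mass borel (quantile (centred_cdf \<rho>)) = density_measure \<rho>"
proof -
  interpret real_distribution "density_measure \<rho>" by (rule density_measure_distribution[OF assms(1)])
  interpret spread "centred_cdf \<rho>" by (rule assms(2))
  show ?thesis
  proof (rule measure_eqI_lessThan)
    fix x :: real
    have "UNIV - {..x} = {x<..}" by auto
    then have "measure (density_measure \<rho>) {x<..} = 1 - cdf (density_measure \<rho>) x"
      using prob_compl[of "{..x}"] by (simp add: cdf_def)
    then show "emeasure (distr unit_mass borel (quantile (centred_cdf \<rho>))) {x<..}
        = emeasure (density_measure \<rho>) {x<..}"
      by (simp add: quantile_Ioi emeasure_eq_measure centred_cdf_def)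
  qed (simp_all add: quantile_Ioi density_measure_def)
qed

text \<open>The ball of radius 1/2 around \<open>m\<close> is a candidate for the infimum. Where
  \<rho> lies between 0 and 1, the absolute difference is linear in \<rho>, and its integral is
  twice the mass outside the ball.\<close>

lemma asymmetry_le:
  assumes "\<rho> \<in> densities"
  shows "asymmetry \<rho> \<le> 2 - 2 * (centred_cdf \<rho> (m + 1/2) - centred_cdf \<rho> (m - 1/2))"
proof -
  let ?I = "{m - 1/2<..m + 1/2}" and ?S = "{\<integral>y. \<bar>\<rho> y - indicator (ball x r) y\<bar> \<partial>lborel | x r. measure lborel (ball x r) = 1}"
  from assms have [measurable]: "\<rho> \<in> borel_measurable borel" and int: "integrable lborel \<rho>"
    and bd: "AE x in lborel. 0 \<le> \<rho> x \<and> \<rho> x \<le> 1" and one: "(\<integral>x. \<rho> x \<partial>lborel) = 1"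
    by (auto simp: densities_def)
  have ball: "ball m (1/2) = {m - 1/2<..<m + 1/2}" by (rule ball_eq_greaterThanLessThan)
  have "bdd_below ?S" by (rule bdd_belowI[of _ 0]) auto
  moreover have "measure lborel (ball m (1/2)) = 1" unfolding ball by simp
  ultimately have "asymmetry \<rho> \<le> (\<integral>y. \<bar>\<rho> y - indicator (ball m (1/2)) y\<bar> \<partial>lborel)"
    unfolding asymmetry_def by (intro cInf_lower) auto
  also have "\<dots> = (\<integral>y. \<rho> y + indicator ?I y - 2 * (\<rho> y * indicator ?I y) \<partial>lborel)"
  proof (rule integral_cong_AE)
    have "AE y in lborel. y \<noteq> m + 1/2" by (rule AE_lborel_singleton)
    with bd show "AE y in lborel. \<bar>\<rho> y - indicator (ball m (1/2)) y\<bar> = \<rho> y + indicator ?I y - 2 * (\<rho> y * indicator ?I y)"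
      by eventually_elim (auto simp: ball indicator_def)
  qed (simp_all add: ball)
  also have "\<dots> = (\<integral>y. \<rho> y \<partial>lborel) + (\<integral>y. indicator ?I y \<partial>lborel) - 2 * (\<integral>y. \<rho> y * indicator ?I y \<partial>lborel)"
    using int by (simp add: integrable_real_mult_indicator)
  also have "(\<integral>y. \<rho> y * indicator ?I y \<partial>lborel) = measure (density_measure \<rho>) ?I"
  proof -
    have "(\<integral>y. \<rho> y *\<^sub>R indicator ?I y \<partial>lborel) = (\<integral>y. (indicator ?I y :: real) \<partial>density_measure \<rho>)"
      unfolding density_measure_def by (rule integral_density[symmetric]) (use bd in \<open>auto elim!: eventually_mono\<close>)
    also have "\<dots> = measure (density_measure \<rho>) ?I"
      by (simp add: density_measure_def)
    finally show ?thesis by simp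
  qed
  also have "\<dots> = centred_cdf \<rho> (m + 1/2) - centred_cdf \<rho> (m - 1/2)"
    by (rule centred_cdf_diff[OF assms, symmetric]) simp
  finally show ?thesis using one by simp
qed

lemma asymmetry_nonneg: "0 \<le> asymmetry \<rho>"
  unfolding asymmetry_def
proof (rule cInf_greatest)
  have "measure lborel (ball 0 (1/2) :: real set) = 1"
    by (simp add: ball_eq_greaterThanLessThan)
  then show "{\<integral>y. \<bar>\<rho> y - indicator (ball x r) y\<bar> \<partial>lborel | x r. measure lborel (ball x r) = 1} \<noteq> {}"
    by blast
qed auto

lemma competitor_of_target:
  assumes \<rho>: "\<rho> \<in> densities" and "half_cdf_spread (centred_cdf \<rho>) m"
  shows "\<exists>\<rho>'\<in>competitors \<rho>. density_measure \<rho>' = distr unit_mass borel (quantile (target_cdf (centred_cdf \<rho>) m))"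
proof -
  interpret real_distribution "density_measure \<rho>" by (rule density_measure_distribution[OF \<rho>])
  interpret half_cdf_spread "centred_cdf \<rho>" m by fact
  from \<rho> have [measurable]: "\<rho> \<in> borel_measurable borel"
    and bd: "AE x in lborel. 0 \<le> \<rho> x \<and> \<rho> x \<le> 1" and one: "(\<integral>x. \<rho> x \<partial>lborel) = 1"
    by (auto simp: densities_def)
  let ?\<nu> = "distr unit_mass borel (quantile (target_cdf (centred_cdf \<rho>) m))"
  \<comment> \<open>The distribution function of the volume left free by both density and target;
    \<open>target_increment\<close> makes it nondecreasing.\<close>
  define K where "K x = x - centred_cdf \<rho> x - target_cdf (centred_cdf \<rho>) m x" for x
  have mono: "K a \<le> K b" if "a \<le> b" for a b
    using target_increment[OF that] by (simp add: K_def gap_def)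
  have cont: "continuous_on UNIV K"
    unfolding K_def by (intro continuous_intros cont_K T.cont_K)
  have K_right: "continuous (at_right a) K" for a
    using cont by (metis UNIV_I continuous_on_eq_continuous_within continuous_within_subset subset_UNIV)
  let ?\<kappa> = "interval_measure K"
  have "emeasure lborel A = emeasure (density lborel (\<lambda>x. ennreal (\<rho> x))) A + emeasure ?\<nu> A + emeasure ?\<kappa> A"
    if "A \<in> sets borel" for A
    unfolding density_measure_def[symmetric]
  proof (rule lborel_sum_three[where ?K1.0 = "centred_cdf \<rho>" and ?K2.0 = "target_cdf (centred_cdf \<rho>) m" and ?K3.0 = K])
    show "emeasure (density_measure \<rho>) {a<..b} = ennreal (centred_cdf \<rho> b - centred_cdf \<rho> a)" if "a \<le> b" for a b
      using centred_cdf_diff[OF \<rho> that] by (simp add: emeasure_eq_measure)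
    show "emeasure ?\<kappa> {a<..b} = ennreal (K b - K a)" if "a \<le> b" for a b
      by (rule emeasure_interval_measure_Ioc[OF that mono K_right])
    show "mono K" by (rule monoI) (rule mono)
    show "continuous_on UNIV K" by (rule cont)
  qed (simp_all add: density_measure_def cont_K T.cont_K mono_K T.mono_K T.quantile_Ioc K_def that)
  then obtain g where [measurable]: "g \<in> borel_measurable borel" and g: "?\<nu> = density lborel g"
    and le: "AE x in lborel. ennreal (\<rho> x) + g x \<le> 1"
    using complementary_density[of ?\<nu> ?\<kappa> "\<lambda>x. ennreal (\<rho> x)"] by auto
  define \<rho>' where "\<rho>' x = enn2real (g x)" for x
  have [measurable]: "\<rho>' \<in> borel_measurable borel" unfolding \<rho>'_def by measurable
  have sum_le: "AE x in lborel. 0 \<le> \<rho>' x \<and> ennreal (\<rho>' x) = g x \<and> 0 \<le> \<rho> x + \<rho>' x \<and> \<rho> x + \<rho>' x \<le> 1"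
    using le bd
  proof eventually_elim
    case (elim x)
    then have "g x < top" by (metis ennreal_one_less_top le_less_trans le_iff_add add.commute)
    then have gx: "ennreal (\<rho>' x) = g x" by (simp add: \<rho>'_def)
    moreover have nn: "0 \<le> \<rho>' x" by (simp add: \<rho>'_def)
    moreover have "\<rho> x + \<rho>' x \<le> 1"
    proof -
      have "ennreal (\<rho> x + \<rho>' x) \<le> ennreal 1" using elim gx nn by simp
      then show ?thesis by (simp only: ennreal_le_iff zero_le_one)
    qed
    ultimately show ?case using elim by simp
  qed
  have density: "density_measure \<rho>' = ?\<nu>"
    unfolding density_measure_def g using sum_le by (intro density_cong) (auto elim!: eventually_mono)
  have "emeasure ?\<nu> UNIV = emeasure lborel {- (1/2)<..<1/2::real}"
    by (simp add: emeasure_distr space_restrict_space emeasure_restrict_space)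
  also have "\<dots> = 1" by simp
  finally have mass: "(\<integral>\<^sup>+x. ennreal (\<rho>' x) \<partial>lborel) = 1"
    unfolding density[symmetric] by (simp add: density_measure_def emeasure_density)
  then have int: "integrable lborel \<rho>'"
    using sum_le by (intro integrableI_nonneg) (auto elim!: eventually_mono)
  moreover have "(\<integral>x. \<rho>' x \<partial>lborel) = 1"
    using integral_eq_nn_integral[of \<rho>' lborel] mass int sum_le by (simp add: eventually_mono)
  ultimately have "\<rho>' \<in> competitors \<rho>"
    unfolding competitors_def using sum_le one by (auto elim!: eventually_mono)
  then show ?thesis using density by blast
qed

lemma transport_cost_bound:
  assumes \<rho>: "\<rho> \<in> densities" and p: "1 \<le> p"
  shows "\<exists>\<rho>'\<in>competitors \<rho>. wasserstein_cost p (density_measure \<rho>) (density_measure \<rho>')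
    \<le> ennreal ((1/2) powr p * (1 - (asymmetry \<rho>)\<^sup>2 / 8))"
proof -
  obtain m where "half_cdf_spread (centred_cdf \<rho>) m" using centred_cdf_half_cdf_spread[OF \<rho>] by blast
  then interpret half_cdf_spread "centred_cdf \<rho>" m .
  obtain \<rho>' where \<rho>': "\<rho>' \<in> competitors \<rho>"
      "density_measure \<rho>' = distr unit_mass borel (quantile (target_cdf (centred_cdf \<rho>) m))"
    using competitor_of_target[OF \<rho> half_cdf_spread_axioms] by blast
  let ?x = "quantile (centred_cdf \<rho>)" and ?y = "quantile (target_cdf (centred_cdf \<rho>) m)"
  \<comment> \<open>The monotone coupling: both coordinates are quantiles of the same level.\<close>
  define \<pi> where "\<pi> = distr unit_mass borel (\<lambda>s. (?x s, ?y s))"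
  have meas: "(\<lambda>s. (?x s, ?y s)) \<in> unit_mass \<rightarrow>\<^sub>M borel"
    unfolding borel_prod[symmetric] by measurable
  have "distr \<pi> borel fst = density_measure \<rho>"
    unfolding \<pi>_def
    by (subst distr_distr[OF _ meas])
      (simp_all add: comp_def borel_measurable_continuous_onI continuous_on_fst distr_quantile_density[OF \<rho> spread_axioms])
  moreover have "distr \<pi> borel snd = density_measure \<rho>'"
    unfolding \<pi>_def \<rho>'
    by (subst distr_distr[OF _ meas]) (simp_all add: comp_def borel_measurable_continuous_onI continuous_on_snd)
  ultimately have "\<pi> \<in> couplings (density_measure \<rho>) (density_measure \<rho>')"
    by (simp add: couplings_def \<pi>_def)
  then have "wasserstein_cost p (density_measure \<rho>) (density_measure \<rho>')
      \<le> (\<integral>\<^sup>+ z. ennreal (\<bar>fst z - snd z\<bar> powr p) \<partial>\<pi>)"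
    unfolding wasserstein_cost_def by (rule INF_lower)
  also have "\<dots> = (\<integral>\<^sup>+ s. ennreal (\<bar>?x s - ?y s\<bar> powr p) \<partial>unit_mass)"
    unfolding \<pi>_def by (subst nn_integral_distr[OF meas]) (simp_all add: borel_prod[symmetric])
  also have "\<dots> \<le> ennreal ((1/2) powr p * (1 - (1/2 - centred_cdf \<rho> (m + 1/2))\<^sup>2 - (1/2 + centred_cdf \<rho> (m - 1/2))\<^sup>2))"
    by (rule quantile_cost[OF p])
  also have "\<dots> \<le> ennreal ((1/2) powr p * (1 - (asymmetry \<rho>)\<^sup>2 / 8))"
  proof (intro ennreal_leI mult_left_mono)
    \<comment> \<open>The factor 8 comes from squaring
      \<open>asymmetry \<rho> \<le> 2 * (a + b)\<close> and using
      \<open>2 * a * b \<le> a\<^sup>2 + b\<^sup>2\<close>.\<close>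
    define a b where "a = 1/2 - centred_cdf \<rho> (m + 1/2)" and "b = 1/2 + centred_cdf \<rho> (m - 1/2)"
    have "asymmetry \<rho> \<le> 2 * (a + b)" using asymmetry_le[OF \<rho>, of m] by (simp add: a_def b_def algebra_simps)
    then have "(asymmetry \<rho>)\<^sup>2 \<le> (2 * (a + b))\<^sup>2" using asymmetry_nonneg by (rule power_mono)
    also have "\<dots> \<le> 8 * (a\<^sup>2 + b\<^sup>2)"
      using sum_squares_bound[of a b] by (simp add: power2_eq_square algebra_simps)
    finally show "1 - (1/2 - centred_cdf \<rho> (m + 1/2))\<^sup>2 - (1/2 + centred_cdf \<rho> (m - 1/2))\<^sup>2 \<le> 1 - (asymmetry \<rho>)\<^sup>2 / 8"
      unfolding a_def[symmetric] b_def[symmetric] by (simp add: field_simps)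
  qed simp
  finally show ?thesis using \<rho>'(1) by blast
qed

section \<open>The ball and the stability estimate\<close>

lemma ennpowr_ennreal: "0 \<le> x \<Longrightarrow> ennpowr (ennreal x) a = ennreal (x powr a)"
  by (simp add: ennpowr_def)

lemma ennpowr_mono:
  assumes "x \<le> y" "0 \<le> a"
  shows "ennpowr x a \<le> ennpowr y a"
proof (cases "y = \<infinity>")
  case False
  then have "x \<noteq> \<infinity>" using assms(1) by (auto simp: top_unique)
  moreover have "enn2real x \<le> enn2real y" using assms(1) False by (intro enn2real_mono) (auto simp: top.not_eq_extremum)
  ultimately show ?thesis using False assms(2) by (auto simp: ennpowr_def intro!: ennreal_leI powr_mono2)
qed (simp add: ennpowr_def)

lemma W_free_powr_le:
  assumes "\<rho>' \<in> competitors \<rho>" "wasserstein_cost p (density_measure \<rho>) (density_measure \<rho>') \<le> ennreal c"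
    and "0 \<le> c" "0 < p"
  shows "ennpowr (W_free p \<rho>) p \<le> ennreal c"
proof -
  have "W_free p \<rho> \<le> wasserstein p (density_measure \<rho>) (density_measure \<rho>')"
    unfolding W_free_def by (rule INF_lower[OF assms(1)])
  also have "\<dots> \<le> ennpowr (ennreal c) (1/p)"
    unfolding wasserstein_def using assms by (intro ennpowr_mono) auto
  finally have "ennpowr (W_free p \<rho>) p \<le> ennpowr (ennpowr (ennreal c) (1/p)) p"
    using assms by (intro ennpowr_mono) auto
  also have "\<dots> = ennreal c" using assms by (simp add: ennpowr_ennreal powr_powr)
  finally show ?thesis .
qed

lemma W_free_powr_ge:
  assumes "\<And>\<rho>'. \<rho>' \<in> competitors \<rho> \<Longrightarrow> ennreal c \<le> wasserstein_cost p (density_measure \<rho>) (density_measure \<rho>')"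
    and "0 \<le> c" "0 < p"
  shows "ennreal c \<le> ennpowr (W_free p \<rho>) p"
proof -
  have "ennpowr (ennreal c) (1/p) \<le> W_free p \<rho>"
    unfolding W_free_def wasserstein_def using assms by (intro INF_greatest ennpowr_mono) auto
  then have "ennpowr (ennpowr (ennreal c) (1/p)) p \<le> ennpowr (W_free p \<rho>) p"
    using assms by (intro ennpowr_mono) auto
  moreover have "ennpowr (ennpowr (ennreal c) (1/p)) p = ennreal c"
    using assms by (simp add: ennpowr_ennreal powr_powr)
  ultimately show ?thesis by simp
qed

section \<open>Lower bound for the ball by a dual potential\<close>

lemma powr_ge_tangent:
  fixes a t p :: real
  assumes "0 < a" "0 \<le> t" "1 \<le> p"
  shows "a powr p + p * a powr (p - 1) * (t - a) \<le> t powr p"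
proof (cases "t = 0")
  case True
  have "a powr p = a powr (p - 1) * a" using assms by (simp add: powr_diff)
  then have "a powr p + p * a powr (p - 1) * (t - a) = (1 - p) * a powr p"
    using True by (simp add: algebra_simps)
  also have "\<dots> \<le> 0" using assms by (simp add: mult_nonpos_nonneg)
  finally show ?thesis using True by simp
next
  case False
  then have "t > 0" using assms by simp
  have "convex_on {0<..} (\<lambda>x. x powr p)"
    using assms(3) by (rule powr_convex)
  then have "p * a powr (p - 1) * (t - a) \<le> t powr p - a powr p"
    using \<open>t > 0\<close> assms
    by (intro convex_on_imp_above_tangent[where A = "{0<..}"]) (auto intro!: derivative_eq_intros simp: interior_open)
  then show ?thesis by simp
qed

text \<open>A Kantorovich potential for the unit interval centred at \<open>c\<close>: shifting each
  half of the interval outwards by 1/2 moves mass along slopes of modulus 1.\<close>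

definition tent :: "real \<Rightarrow> real \<Rightarrow> real" where
  "tent c t = max 0 (1 - \<bar>t - c\<bar>)"

lemma tent_measurable [measurable]: "tent c \<in> borel_measurable borel"
  unfolding tent_def by measurable

lemma tent_bounds: "0 \<le> tent c t" "tent c t \<le> 1"
  by (auto simp: tent_def)

lemma tent_lipschitz: "tent c x - tent c y \<le> \<bar>x - y\<bar>"
  unfolding tent_def by linarith

text \<open>Needed for \<open>h = 1/2\<close>, the unit interval, and \<open>h = 1\<close>, the
  whole support, with values 3/4 and 1.\<close>

lemma tent_integral:
  assumes "0 \<le> h" "h \<le> 1"
  shows "has_bochner_integral lborel (\<lambda>t. tent c t * indicator {c - h..c + h} t) (2 * h - h\<^sup>2)"
proof -
  have "has_bochner_integral lborel (\<lambda>t. (1 - (t - c)) * indicator {c..c + h} t)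
      ((h - h\<^sup>2 / 2) - 0)"
  proof -
    have "((\<lambda>t. (t - c) - (t - c)\<^sup>2 / 2) has_real_derivative 1 - (t - c)) (at t)" for t
      by (auto intro!: derivative_eq_intros simp: field_simps)
    then show ?thesis
      using assms has_bochner_integral_FTC_Icc_real[of c "c + h" "\<lambda>t. (t - c) - (t - c)\<^sup>2 / 2" "\<lambda>t. 1 - (t - c)"]
      by simp
  qed
  moreover have "has_bochner_integral lborel (\<lambda>t. (1 + (t - c)) * indicator {c - h..c} t)
      (0 - (- h + h\<^sup>2 / 2))"
  proof -
    have "((\<lambda>t. (t - c) + (t - c)\<^sup>2 / 2) has_real_derivative 1 + (t - c)) (at t)" for t
      by (auto intro!: derivative_eq_intros simp: field_simps)
    then show ?thesis
      using assms has_bochner_integral_FTC_Icc_real[of "c - h" c "\<lambda>t. (t - c) + (t - c)\<^sup>2 / 2" "\<lambda>t. 1 + (t - c)"]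
      by simp
  qed
  ultimately have "has_bochner_integral lborel
      (\<lambda>t. (1 - (t - c)) * indicator {c..c + h} t + (1 + (t - c)) * indicator {c - h..c} t)
      (((h - h\<^sup>2 / 2) - 0) + (0 - (- h + h\<^sup>2 / 2)))"
    by (rule has_bochner_integral_add)
  moreover have "AE t in lborel. (1 - (t - c)) * indicator {c..c + h} t + (1 + (t - c)) * indicator {c - h..c} t
      = tent c t * indicator {c - h..c + h} t"
  proof -
    have "AE t in lborel. t \<noteq> c" by (rule AE_lborel_singleton)
    then show ?thesis
      by eventually_elim (use assms in \<open>auto simp: tent_def indicator_def\<close>)
  qed
  moreover have "((h - h\<^sup>2 / 2) - 0) + (0 - (- h + h\<^sup>2 / 2)) = 2 * h - h\<^sup>2" by simp
  ultimately show ?thesis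
    by (subst has_bochner_integral_cong_AE[symmetric]) simp_all
qed

text \<open>The potential has integral 3/4 against the ball and at most 1/4 against a competitor,
  which must live in the remaining space. So the mean distance under any coupling is at least 1/2,
  and the tangent at 1/2 converts this into the cost.\<close>

lemma wasserstein_cost_ball_ge:
  fixes c p :: real
  defines "B \<equiv> {c - 1/2<..<c + 1/2}"
  assumes \<rho>': "\<rho>' \<in> competitors (indicator B)" and p: "1 \<le> p"
  shows "ennreal ((1/2) powr p) \<le> wasserstein_cost p (density_measure (indicator B)) (density_measure \<rho>')"
  unfolding wasserstein_cost_def
proof (rule INF_greatest)
  let ?\<chi> = "indicator B :: real \<Rightarrow> real"
  fix \<pi> assume \<pi>: "\<pi> \<in> couplings (density_measure ?\<chi>) (density_measure \<rho>')"
  have [measurable]: "B \<in> sets borel" by (simp add: B_def)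
  have "?\<chi> \<in> densities" by (auto simp: densities_def B_def indicator_def)
  then interpret \<mu>: real_distribution "density_measure ?\<chi>" by (rule density_measure_distribution)
  from \<rho>' have [measurable]: "\<rho>' \<in> borel_measurable borel" and int': "integrable lborel \<rho>'"
    and nn: "AE x in lborel. 0 \<le> \<rho>' x" and le: "AE x in lborel. ?\<chi> x + \<rho>' x \<le> 1"
    and one: "(\<integral>x. \<rho>' x \<partial>lborel) = 1"
    by (auto simp: competitors_def B_def)
  from \<pi> have sets_\<pi>: "sets \<pi> = sets (borel :: (real \<times> real) measure)"
    and fst_\<pi>: "distr \<pi> borel fst = density_measure ?\<chi>" and snd_\<pi>: "distr \<pi> borel snd = density_measure \<rho>'"
    by (auto simp: couplings_def)
  have [measurable_cong]: "sets \<pi> = sets (borel \<Otimes>\<^sub>M borel)" by (simp only: sets_\<pi> borel_prod)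
  have "emeasure \<pi> (space \<pi>) = emeasure (distr \<pi> borel fst) UNIV"
    by (subst emeasure_distr) (simp_all)
  also have "\<dots> = 1" unfolding fst_\<pi> using \<mu>.emeasure_space_1 by simp
  finally interpret \<pi>: prob_space \<pi> by (rule prob_spaceI)
  have int_tent: "integrable \<pi> (\<lambda>z. tent c (fst z))" "integrable \<pi> (\<lambda>z. tent c (snd z))"
    by (rule \<pi>.integrable_const_bound[where B = 1]; simp add: tent_bounds)+
  have B_tent: "(\<integral>t. tent c t * indicator B t \<partial>lborel) = 3/4"
    and tent_B: "integrable lborel (\<lambda>t. tent c t * indicator B t)"
  proof -
    have "has_bochner_integral lborel (\<lambda>t. tent c t * indicator B t) (2 * (1/2) - (1/2)\<^sup>2)"
    proof (subst has_bochner_integral_cong_AE)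
      have "AE t in lborel. t \<noteq> c - 1/2" "AE t in lborel. t \<noteq> c + 1/2" by (rule AE_lborel_singleton)+
      then show "AE t in lborel. tent c t * indicator B t = tent c t * indicator {c - 1/2..c + 1/2} t"
        by eventually_elim (auto simp: B_def indicator_def)
      show "has_bochner_integral lborel (\<lambda>t. tent c t * indicator {c - 1/2..c + 1/2} t) (2 * (1/2) - (1/2)\<^sup>2)"
        by (rule tent_integral) simp_all
    qed simp_all
    then show "(\<integral>t. tent c t * indicator B t \<partial>lborel) = 3/4" "integrable lborel (\<lambda>t. tent c t * indicator B t)"
      by (auto simp: has_bochner_integral_iff power2_eq_square)
  qed
  have tent: "has_bochner_integral lborel (tent c) 1"
  proof -
    have eq: "(\<lambda>t. tent c t * indicator {c - 1..c + 1} t) = tent c"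
      by (rule ext) (auto simp: tent_def indicator_def)
    show ?thesis using tent_integral[of 1 c] unfolding eq by simp
  qed
  have "(\<integral>z. tent c (fst z) \<partial>\<pi>) = (\<integral>t. tent c t \<partial>distr \<pi> borel fst)"
    by (rule integral_distr[symmetric]) simp_all
  also have "\<dots> = (\<integral>t. indicator B t *\<^sub>R tent c t \<partial>lborel)"
    unfolding fst_\<pi> density_measure_def by (rule integral_density) simp_all
  also have "\<dots> = 3/4" using B_tent by (simp add: mult.commute)
  finally have fst: "(\<integral>z. tent c (fst z) \<partial>\<pi>) = 3/4" .
  have "(\<integral>z. tent c (snd z) \<partial>\<pi>) = (\<integral>t. tent c t \<partial>distr \<pi> borel snd)"
    by (rule integral_distr[symmetric]) simp_all
  also have "\<dots> = (\<integral>t. \<rho>' t *\<^sub>R tent c t \<partial>lborel)"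
    unfolding snd_\<pi> density_measure_def by (rule integral_density) (use nn in simp_all)
  also have "\<dots> \<le> (\<integral>t. tent c t - tent c t * indicator B t \<partial>lborel)"
  proof (rule integral_mono_AE')
    show "integrable lborel (\<lambda>t. tent c t - tent c t * indicator B t)"
      using tent tent_B by (auto simp: has_bochner_integral_iff)
    show "AE t in lborel. \<rho>' t *\<^sub>R tent c t \<le> tent c t - tent c t * indicator B t"
      using le
    proof eventually_elim
      case (elim t)
      then have "\<rho>' t * tent c t \<le> (1 - indicator B t) * tent c t"
        using tent_bounds(1) by (intro mult_right_mono) simp_all
      then show ?case by (simp add: algebra_simps)
    qed
    show "AE t in lborel. 0 \<le> tent c t - tent c t * indicator B t"
      using tent_bounds(1)[of c] by (auto simp: indicator_def)
  qed
  also have "\<dots> = 1/4" using tent tent_B B_tent by (simp add: has_bochner_integral_iff)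
  finally have snd: "(\<integral>z. tent c (snd z) \<partial>\<pi>) \<le> 1/4" .
  define k where "k = p * (1/2) powr (p - 1)"
  define \<psi> where "\<psi> z = (1/2) powr p + k * (tent c (fst z) - tent c (snd z) - 1/2)" for z
  have k: "0 \<le> k" using p by (simp add: k_def)
  have int_\<psi>: "integrable \<pi> \<psi>" unfolding \<psi>_def using int_tent by simp
  have "(\<integral>z. \<psi> z \<partial>\<pi>) = (1/2) powr p + k * ((\<integral>z. tent c (fst z) \<partial>\<pi>) - (\<integral>z. tent c (snd z) \<partial>\<pi>) - 1/2)"
    unfolding \<psi>_def using int_tent by (simp add: \<pi>.prob_space)
  then have "(1/2) powr p \<le> (\<integral>z. \<psi> z \<partial>\<pi>)"
    using k fst snd by simp
  \<comment> \<open>The cost may be infinite, so the positive part of \<psi> serves as an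
    integrable, nonnegative minorant.\<close>
  also have "\<dots> \<le> (\<integral>z. max 0 (\<psi> z) \<partial>\<pi>)"
    using int_\<psi> by (intro integral_mono integrable_max) simp_all
  finally have "ennreal ((1/2) powr p) \<le> ennreal (\<integral>z. max 0 (\<psi> z) \<partial>\<pi>)" by (rule ennreal_leI)
  also have "\<dots> = (\<integral>\<^sup>+z. ennreal (max 0 (\<psi> z)) \<partial>\<pi>)"
    using int_\<psi> by (intro nn_integral_eq_integral[symmetric] integrable_max) simp_all
  also have "\<dots> \<le> (\<integral>\<^sup>+z. ennreal (\<bar>fst z - snd z\<bar> powr p) \<partial>\<pi>)"
  proof (intro nn_integral_mono ennreal_leI)
    fix z
    have "\<psi> z \<le> (1/2) powr p + k * (\<bar>fst z - snd z\<bar> - 1/2)"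
      unfolding \<psi>_def using k tent_lipschitz[of c "fst z" "snd z"] by (intro add_left_mono mult_left_mono) simp_all
    also have "\<dots> \<le> \<bar>fst z - snd z\<bar> powr p"
      unfolding k_def using p by (intro powr_ge_tangent) simp_all
    finally show "max 0 (\<psi> z) \<le> \<bar>fst z - snd z\<bar> powr p" by simp
  qed
  finally show "ennreal ((1/2) powr p) \<le> (\<integral>\<^sup>+z. ennreal (\<bar>fst z - snd z\<bar> powr p) \<partial>\<pi>)" .
qed

theorem theorem4p2:
  fixes p :: real
  assumes "p > 1"
  shows "\<exists>C::real. C > 0 \<and>
    (\<forall>x r::real. measure lborel (ball x r) = 1 \<longrightarrow>
      (\<forall>\<rho>\<in>densities.
        enn2ereal (ennpowr (W_free p (indicator (ball x r))) p) - enn2ereal (ennpowr (W_free p \<rho>) p)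
          \<ge> ereal (C * (asymmetry \<rho>)\<^sup>2)))"
proof (intro exI[of _ "(1/2) powr p / 8"] conjI allI impI ballI)
  fix x r :: real and \<rho> :: "real \<Rightarrow> real"
  assume unit: "measure lborel (ball x r) = 1" and \<rho>: "\<rho> \<in> densities"
  let ?c = "(1/2) powr p * (1 - (asymmetry \<rho>)\<^sup>2 / 8)"
  have ball: "ball x r = {x - 1/2<..<x + 1/2}"
    unfolding unit_ball_radius[OF unit] by (rule ball_eq_greaterThanLessThan)
  have lower: "ennreal ((1/2) powr p) \<le> ennpowr (W_free p (indicator (ball x r))) p"
    unfolding ball using assms by (intro W_free_powr_ge wasserstein_cost_ball_ge) simp_all
  obtain m where "half_cdf_spread (centred_cdf \<rho>) m" using centred_cdf_half_cdf_spread[OF \<rho>] by blast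
  then interpret half_cdf_spread "centred_cdf \<rho>" m .
  \<comment> \<open>\<open>ennreal\<close> sends negative numbers to 0; this bound keeps
    \<open>?c\<close> nonnegative, so that the final difference is exact.\<close>
  have "asymmetry \<rho> \<le> 2"
    using asymmetry_le[OF \<rho>, of m] median_bounds by simp
  then have "(asymmetry \<rho>)\<^sup>2 \<le> 2\<^sup>2" using asymmetry_nonneg by (rule power_mono)
  then have c: "0 \<le> ?c" by simp
  obtain \<rho>' where "\<rho>' \<in> competitors \<rho>"
      "wasserstein_cost p (density_measure \<rho>) (density_measure \<rho>') \<le> ennreal ?c"
    using transport_cost_bound[OF \<rho>, of p] assms by auto
  then have upper: "ennpowr (W_free p \<rho>) p \<le> ennreal ?c"
    using c assms by (intro W_free_powr_le) simp_all
  have "ereal ((1/2) powr p / 8 * (asymmetry \<rho>)\<^sup>2) = enn2ereal (ennreal ((1/2) powr p)) - enn2ereal (ennreal ?c)"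
    using c by (simp add: enn2ereal_ennreal algebra_simps)
  also have "\<dots> \<le> enn2ereal (ennpowr (W_free p (indicator (ball x r))) p) - enn2ereal (ennpowr (W_free p \<rho>) p)"
    by (rule ereal_minus_mono[OF lower[unfolded less_eq_ennreal.rep_eq] upper[unfolded less_eq_ennreal.rep_eq]])
  finally show "ereal ((1/2) powr p / 8 * (asymmetry \<rho>)\<^sup>2)
      \<le> enn2ereal (ennpowr (W_free p (indicator (ball x r))) p) - enn2ereal (ennpowr (W_free p \<rho>) p)" .
qed simp

end
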